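(* Let $f:\mathcal{S}^n\to\mathbb{R}$ be convex and continuous, let $A_1,\dots,A_m\in\mathcal{S}^n$, let $\mathcal{A}:\mathcal{S}^n\to\mathbb{R}^m$ be given by $\mathcal{A}(X)_i=\langle X,A_i\rangle$, let $x_0\in\mathbb{R}^n$, $X_0=x_0x_0^t$, and let $b=\mathcal{A}(X_0)$. Suppose that $X_0$ minimizes $$\min f(X)\ \text{ subject to }\ X\succeq 0,\ \mathcal{A}(X)=b.$$ If $\mathcal{A}$ satisfies the completeness condition at $X_0$, then strong duality holds for this problem and a dual certificate exists at $X_0$.
   Context: $\mathcal{S}^n$ is the space of real symmetric $n\times n$ matrices with inner product $\langle X,Y\rangle=\operatorname{tr}(Y^tX)$; $\perp$ denotes orthogonality for this inner product. $X\succeq 0$ (resp. $X\preceq 0$) means $X$ is positive (resp. negative) semidefinite. The adjoint of $\mathcal{A}$ is $\mathcal{A}^*\lambda=\sum_{i=1}^m\lambda_iA_i$. For $x,y\in\mathbb{R}^n$, $x\otimes y:=xy^t+yx^t$. $\partial f$ denotes the convex subdifferential with respect to $\langle\cdot,\cdot\rangle$ on $\mathcal{S}^n$. Let $S=\{\mathcal{A}^*\lambda+Q : \lambda\in\mathbb{R}^m,\ Q\in\mathcal{S}^n,\ Q\preceq 0,\ Q\perp X_0\}$. The completeness condition at $X_0=x_0x_0^t$ is: whenever $A=\mathcal{A}^*\lambda$ for some $\lambda\in\mathbb{R}^m$ with $A\succeq 0$ and $A\perp x_0x_0^t$, then $y\otimes q\in S$ for all $y\in\mathbb{R}^n$ and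 all $q\in\operatorname{range}(A)$. A dual certificate at $X_0$ is a pair $(\lambda,Q)\in\mathbb{R}^m\times\mathcal{S}^n$ such that $\mathcal{A}^*\lambda+Q\in-\partial f(X_0)$, $Q\preceq 0$, and $Q\perp X_0$. The Lagrangian is $\mathcal{L}(X,\lambda,Q)=f(X)+\langle\lambda,\mathcal{A}(X)-b\rangle+\langle Q,X\rangle$, and the dual problem is $\sup_{Q\preceq 0,\,\lambda}\ \inf_{X\in\mathcal{S}^n}\mathcal{L}(X,\lambda,Q)$. Strong duality holds when the optimal values of the primal and dual problems are equal and the dual optimum is attained. *)

theory Defs
  imports "HOL-Analysis.Analysis"
begin

text \<open>The space of symmetric matrices is a carrier set inside the type of square matrices; functions
  on it are constrained, and subgradients and infima taken, on this carrier only.\<close>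

definition sym_mats :: "(real ^ 'n ^ 'n) set" where
  "sym_mats = {X. transpose X = X}"

text \<open>The library inner product on matrices is the trace inner product.\<close>

lemma inner_matrix_eq_trace:
  fixes X Y :: "real ^ 'n ^ 'n"
  shows "X \<bullet> Y = trace (transpose Y ** X)"
  unfolding trace_def matrix_matrix_mult_def transpose_def inner_vec_def
  by (subst sum.swap) (simp add: mult.commute)

definition psd :: "real ^ 'n ^ 'n \<Rightarrow> bool" where
  "psd X \<longleftrightarrow> X \<in> sym_mats \<and> (\<forall>v. 0 \<le> v \<bullet> (X *v v))"

definition nsd :: "real ^ 'n ^ 'n \<Rightarrow> bool" where
  "nsd X \<longleftrightarrow> X \<in> sym_mats \<and> (\<forall>v. v \<bullet> (X *v v) \<le> 0)"

definition outer :: "real ^ 'n \<Rightarrow> real ^ 'n \<Rightarrow> real ^ 'n ^ 'n" where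
  "outer x y = (\<chi> i j. x $ i * y $ j)"

definition sym_tensor :: "real ^ 'n \<Rightarrow> real ^ 'n \<Rightarrow> real ^ 'n ^ 'n" where
  "sym_tensor x y = outer x y + outer y x"

definition meas :: "('m \<Rightarrow> real ^ 'n ^ 'n) \<Rightarrow> real ^ 'n ^ 'n \<Rightarrow> real ^ 'm" where
  "meas A X = (\<chi> i. X \<bullet> A i)"

definition meas_adj :: "('m::finite \<Rightarrow> real ^ 'n ^ 'n) \<Rightarrow> real ^ 'm \<Rightarrow> real ^ 'n ^ 'n" where
  "meas_adj A l = (\<Sum>i\<in>UNIV. l $ i *\<^sub>R A i)"

definition cert_set :: "('m::finite \<Rightarrow> real ^ 'n ^ 'n) \<Rightarrow> real ^ 'n ^ 'n \<Rightarrow> (real ^ 'n ^ 'n) set" where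
  "cert_set A X0 = {meas_adj A l + Q | l Q. nsd Q \<and> orthogonal Q X0}"

definition completeness :: "('m::finite \<Rightarrow> real ^ 'n ^ 'n) \<Rightarrow> real ^ 'n \<Rightarrow> bool" where
  "completeness A x0 \<longleftrightarrow>
    (\<forall>l. psd (meas_adj A l) \<and> orthogonal (meas_adj A l) (outer x0 x0) \<longrightarrow>
      (\<forall>y. \<forall>q \<in> range (\<lambda>v. meas_adj A l *v v). sym_tensor y q \<in> cert_set A (outer x0 x0)))"

definition subdifferential :: "(real ^ 'n ^ 'n \<Rightarrow> real) \<Rightarrow> real ^ 'n ^ 'n \<Rightarrow> (real ^ 'n ^ 'n) set" where
  "subdifferential f X = {G \<in> sym_mats. \<forall>Y \<in> sym_mats. f X + G \<bullet> (Y - X) \<le> f Y}"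

definition dual_certificate ::
  "(real ^ 'n ^ 'n \<Rightarrow> real) \<Rightarrow> ('m::finite \<Rightarrow> real ^ 'n ^ 'n) \<Rightarrow> real ^ 'n ^ 'n \<Rightarrow>
    real ^ 'm \<Rightarrow> real ^ 'n ^ 'n \<Rightarrow> bool" where
  "dual_certificate f A X0 l Q \<longleftrightarrow>
    meas_adj A l + Q \<in> uminus ` subdifferential f X0 \<and> nsd Q \<and> orthogonal Q X0"

definition feasible :: "('m \<Rightarrow> real ^ 'n ^ 'n) \<Rightarrow> real ^ 'm \<Rightarrow> real ^ 'n ^ 'n \<Rightarrow> bool" where
  "feasible A b X \<longleftrightarrow> psd X \<and> meas A X = b"

definition lagrangian ::
  "(real ^ 'n ^ 'n \<Rightarrow> real) \<Rightarrow> ('m::finite \<Rightarrow> real ^ 'n ^ 'n) \<Rightarrow> real ^ 'm \<Rightarrow>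
    real ^ 'n ^ 'n \<Rightarrow> real ^ 'm \<Rightarrow> real ^ 'n ^ 'n \<Rightarrow> real" where
  "lagrangian f A b X l Q = f X + l \<bullet> (meas A X - b) + Q \<bullet> X"

text \<open>Optimal values are extended reals, since the inner infimum may be $-\infty$.\<close>

definition primal_value ::
  "(real ^ 'n ^ 'n \<Rightarrow> real) \<Rightarrow> ('m \<Rightarrow> real ^ 'n ^ 'n) \<Rightarrow> real ^ 'm \<Rightarrow> ereal" where
  "primal_value f A b = (INF X \<in> Collect (feasible A b). ereal (f X))"

definition dual_function ::
  "(real ^ 'n ^ 'n \<Rightarrow> real) \<Rightarrow> ('m::finite \<Rightarrow> real ^ 'n ^ 'n) \<Rightarrow> real ^ 'm \<Rightarrow>
    real ^ 'm \<Rightarrow> real ^ 'n ^ 'n \<Rightarrow> ereal" where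
  "dual_function f A b l Q = (INF X \<in> sym_mats. ereal (lagrangian f A b X l Q))"

definition dual_value ::
  "(real ^ 'n ^ 'n \<Rightarrow> real) \<Rightarrow> ('m::finite \<Rightarrow> real ^ 'n ^ 'n) \<Rightarrow> real ^ 'm \<Rightarrow> ereal" where
  "dual_value f A b = (SUP (l, Q) \<in> UNIV \<times> Collect nsd. dual_function f A b l Q)"

definition strong_duality ::
  "(real ^ 'n ^ 'n \<Rightarrow> real) \<Rightarrow> ('m::finite \<Rightarrow> real ^ 'n ^ 'n) \<Rightarrow> real ^ 'm \<Rightarrow> bool" where
  "strong_duality f A b \<longleftrightarrow>
    primal_value f A b = dual_value f A b \<and>
    (\<exists>l Q. nsd Q \<and> dual_function f A b l Q = dual_value f A b)"

end

theory Submission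
  imports Defs
begin

text \<open>Minimality of \<open>X0\<close> gives a subgradient \<open>G\<close> whose negative is normal to
  the feasible set at \<open>X0\<close>, so the point is that such a normal lies in the certificate cone.
  Take a positive semidefinite \<open>E = meas_adj A l\<close> orthogonal to \<open>X0\<close> of maximal
  rank. Every feasible matrix lives on the kernel of \<open>E\<close>, and the conditions
  \<open>H *v q = 0\<close>, \<open>q\<close> in the range of \<open>E\<close>, are dual to the matrices
  \<open>sym_tensor y q\<close>, which completeness puts into the certificate cone. After this one
  facial reduction the problem is nondegenerate, and a separating hyperplane yields the
  multipliers.\<close>

section \<open>Bounded affine functions and subgradients at constrained minimizers\<close>

lemma affine_bound_imp_nonpos:
  fixes y :: real
  assumes "\<And>t. t > 0 \<Longrightarrow> c + t * y \<le> d"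
  shows "y \<le> 0"
proof (rule ccontr)
  assume y: "\<not> y \<le> 0"
  have "c + ((\<bar>d - c\<bar> + 1) / y) * y \<le> d"
    by (rule assms) (use y in \<open>simp add: add_nonneg_pos\<close>)
  then show False using y by auto
qed

lemma affine_bound_imp_zero:
  fixes y :: real
  assumes "\<And>t. c + t * y \<le> d"
  shows "y = 0"
proof -
  have "y \<le> 0" by (rule affine_bound_imp_nonpos[of c y d]) (rule assms)
  moreover have "- y \<le> 0"
    by (rule affine_bound_imp_nonpos[of c _ d]) (use assms[of "- t" for t] in simp)
  ultimately show ?thesis by simp
qed

text \<open>Separate the strict epigraph of \<open>f\<close> from \<open>C\<close> placed at height
  \<open>f x0\<close>, and divide the normal by its vertical component. A single hyperplane yields
  both inequalities.\<close>

lemma constrained_minimizer_subgradient: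
  fixes f :: "'a::euclidean_space \<Rightarrow> real"
  assumes f: "convex_on UNIV f" and C: "convex C" "x0 \<in> C"
    and min: "\<And>x. x \<in> C \<Longrightarrow> f x0 \<le> f x"
  obtains g where "\<And>y. f x0 + g \<bullet> (y - x0) \<le> f y" and "\<And>x. x \<in> C \<Longrightarrow> 0 \<le> g \<bullet> (x - x0)"
proof -
  define E where "E = {(x, r). f x < r}"
  have "convex E"
    unfolding E_def
  proof (rule convexI, clarsimp)
    fix x y :: 'a and r s u v :: real
    assume h: "f x < r" "f y < s" "0 \<le> u" "0 \<le> v" "u + v = 1"
    have "f (u *\<^sub>R x + v *\<^sub>R y) \<le> u * f x + v * f y"
      using f h unfolding convex_on_def by simp
    also have "\<dots> < u * r + v * s"
    proof (cases "u = 0")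
      case False
      then show ?thesis using h by (intro add_less_le_mono mult_strict_left_mono mult_left_mono) auto
    qed (use h in simp)
    finally show "f (u *\<^sub>R x + v *\<^sub>R y) < u * r + v * s" .
  qed
  moreover have "convex (C \<times> {f x0})" using C by (intro convex_Times) auto
  moreover have "(x0, f x0 + 1) \<in> E" by (simp add: E_def)
  moreover have "(C \<times> {f x0}) \<inter> E = {}" using min by (force simp: E_def)
  ultimately obtain w \<beta> where w: "w \<noteq> 0" "\<forall>p\<in>C \<times> {f x0}. w \<bullet> p \<le> \<beta>" "\<forall>p\<in>E. \<beta> \<le> w \<bullet> p"
    using separating_hyperplane_sets[of "C \<times> {f x0}" E] C by blast
  obtain a c where ac: "w = (a, c)" by (cases w)
  have CC: "a \<bullet> x + c * f x0 \<le> \<beta>" if "x \<in> C" for x using w(2) that by (auto simp: ac)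
  have EE: "\<beta> \<le> a \<bullet> x + c * r" if "f x < r" for x r using w(3) that by (auto simp: ac E_def)
  have le: "a \<bullet> x0 + c * f x0 \<le> a \<bullet> x + c * r" if "f x < r" for x r
    using CC[OF C(2)] EE[OF that] by linarith
  have "c \<ge> 0" using le[of x0 "f x0 + 1"] by (simp add: algebra_simps)
  \<comment> \<open>As \<open>f\<close> is finite everywhere, a vertical hyperplane can be tested at
    \<open>x0 - a\<close>, which forces \<open>a = 0\<close> as well.\<close>
  moreover have "c \<noteq> 0"
  proof
    assume c: "c = 0"
    have "a \<bullet> a \<le> 0" using le[of "x0 - a" "f (x0 - a) + 1"] by (simp add: c inner_diff_right)
    then have "a = 0" by (metis inner_eq_zero_iff inner_ge_zero order_antisym)
    then show False using w(1) ac c by (simp add: zero_prod_def)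
  qed
  ultimately have c: "c > 0" by simp
  have lef: "a \<bullet> x0 + c * f x0 \<le> a \<bullet> y + c * f y" for y
  proof (rule field_le_epsilon)
    fix e :: real assume "e > 0"
    then show "a \<bullet> x0 + c * f x0 \<le> a \<bullet> y + c * f y + e"
      using le[of y "f y + e / c"] c by (simp add: algebra_simps)
  qed
  \<comment> \<open>Letting the height decrease to \<open>f x0\<close> puts the point
    \<open>(x0, f x0)\<close> on the hyperplane itself, so the bound on \<open>C\<close> becomes a
    normal-cone inequality.\<close>
  have bet: "\<beta> \<le> a \<bullet> x0 + c * f x0"
  proof (rule field_le_epsilon)
    fix e :: real assume "e > 0"
    then show "\<beta> \<le> a \<bullet> x0 + c * f x0 + e"
      using EE[of x0 "f x0 + e / c"] c by (simp add: algebra_simps)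
  qed
  show ?thesis
  proof
    show "f x0 + (- (1 / c) *\<^sub>R a) \<bullet> (y - x0) \<le> f y" for y
      using lef[of y] c by (simp add: inner_diff_right field_simps)
    show "0 \<le> (- (1 / c) *\<^sub>R a) \<bullet> (x - x0)" if "x \<in> C" for x
      using CC[OF that] bet c by (simp add: inner_diff_right field_simps)
  qed
qed

section \<open>Rank-one matrices, symmetric matrices and quadratic forms\<close>

lemma inner_outer: "X \<bullet> outer x y = x \<bullet> (X *v y)"
  by (simp add: inner_vec_def outer_def matrix_vector_mult_def sum_distrib_left mult_ac)

lemma outer_mult_vec: "outer x y *v v = (y \<bullet> v) *\<^sub>R x"
  by (simp add: vec_eq_iff outer_def matrix_vector_mult_def inner_vec_def sum_distrib_left mult_ac)

lemma transpose_outer: "transpose (outer x y) = outer y x"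
  by (simp add: vec_eq_iff outer_def transpose_def mult.commute)

lemma outer_mem_sym_mats: "outer x x \<in> sym_mats"
  by (simp add: sym_mats_def transpose_outer)

lemma sym_tensor_mem_sym_mats: "sym_tensor x y \<in> sym_mats"
  by (auto simp: sym_mats_def sym_tensor_def outer_def transpose_def vec_eq_iff)

lemma uminus_sym_tensor: "- sym_tensor x y = sym_tensor (- x) y"
  by (simp add: sym_tensor_def outer_def vec_eq_iff)

lemma subspace_sym_mats: "subspace sym_mats"
  by (auto simp: subspace_def sym_mats_def transpose_def vec_eq_iff)

lemma sym_mats_inner_commute:
  "X \<in> sym_mats \<Longrightarrow> x \<bullet> (X *v y) = (X *v x) \<bullet> y"
  by (metis (mono_tags) dot_lmul_matrix mem_Collect_eq sym_mats_def transpose_matrix_vector)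

lemma inner_sym_tensor: "B \<in> sym_mats \<Longrightarrow> B \<bullet> sym_tensor y q = 2 * (y \<bullet> (B *v q))"
  by (simp add: sym_tensor_def inner_add_right inner_outer sym_mats_inner_commute[of B q y] inner_commute)

lemma inner_transpose: "transpose X \<bullet> transpose Y = (X :: real^'n^'m) \<bullet> Y"
  unfolding inner_vec_def transpose_def by simp (rule sum.swap)

text \<open>A nonnegative quadratic form is minimal where it vanishes, so its gradient
  \<open>2 *\<^sub>R (E *v v)\<close> is zero there. A small step from \<open>v\<close> against
  \<open>E *v v\<close> makes this quantitative.\<close>

lemma psd_mult_vec_eq_0:
  assumes "psd E" "v \<bullet> (E *v v) = 0"
  shows "E *v v = 0"
proof -
  let ?w = "E *v v"
  have sym: "E \<in> sym_mats" and nonneg: "\<And>u. 0 \<le> u \<bullet> (E *v u)" using assms by (auto simp: psd_def)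
  have "2 * (?w \<bullet> ?w) \<le> 0 + e" if "e > 0" for e
  proof -
    let ?k = "?w \<bullet> (E *v ?w)"
    \<comment> \<open>Small enough for the second-order term to stay below \<open>e\<close>; the
      added 1 covers \<open>?k = 0\<close>.\<close>
    define t where "t = e / (?k + 1)"
    have k: "?k \<ge> 0" by (rule nonneg)
    have t: "t > 0" "t * ?k \<le> e" using k that by (auto simp: t_def field_simps)
    have "0 \<le> (v - t *\<^sub>R ?w) \<bullet> (E *v (v - t *\<^sub>R ?w))" by (rule nonneg)
    also have "\<dots> = t * (t * ?k - 2 * (?w \<bullet> ?w))"
      using assms(2) sym_mats_inner_commute[OF sym, of v ?w]
      by (simp add: matrix_vector_mult_diff_distrib matrix_vector_mult_scaleR inner_diff_left
          inner_diff_right algebra_simps inner_commute)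
    finally show ?thesis using t by (simp add: zero_le_mult_iff)
  qed
  then have "2 * (?w \<bullet> ?w) \<le> 0" by (rule field_le_epsilon)
  then have "?w \<bullet> ?w = 0" using inner_ge_zero[of ?w] by linarith
  then show ?thesis by simp
qed

section \<open>The measurement map, its adjoint and the certificate cone\<close>

lemma meas_adj_add: "meas_adj A (l + k) = meas_adj A l + meas_adj A k"
  by (simp add: meas_adj_def scaleR_left_distrib sum.distrib)

lemma meas_adj_scaleR: "meas_adj A (c *\<^sub>R l) = c *\<^sub>R meas_adj A l"
  by (simp add: meas_adj_def scaleR_sum_right)

lemma meas_adj_axis: "meas_adj A (axis i c) = c *\<^sub>R A i"
proof -
  have "meas_adj A (axis i c) = (\<Sum>j\<in>UNIV. if j = i then c *\<^sub>R A i else 0)"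
    unfolding meas_adj_def by (intro sum.cong) (auto simp: axis_def)
  then show ?thesis by simp
qed

lemma inner_meas: "l \<bullet> meas A X = meas_adj A l \<bullet> X"
  by (simp add: meas_def meas_adj_def inner_vec_def[of l] inner_sum_left inner_commute[of X])

lemma meas_add: "meas A (X + Y) = meas A X + meas A Y"
  by (simp add: meas_def vec_eq_iff inner_add_left)

lemma meas_scaleR: "meas A (c *\<^sub>R X) = c *\<^sub>R meas A X"
  by (simp add: meas_def vec_eq_iff)

lemma nsd_add: "nsd P \<Longrightarrow> nsd Q \<Longrightarrow> nsd (P + Q)"
  using subspace_add[OF subspace_sym_mats]
  by (auto simp: nsd_def matrix_vector_mult_add_rdistrib inner_add_right add_nonpos_nonpos)

lemma nsd_scaleR: "nsd P \<Longrightarrow> c \<ge> 0 \<Longrightarrow> nsd (c *\<^sub>R P)"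
  using subspace_scale[OF subspace_sym_mats]
  by (auto simp: nsd_def scaleR_matrix_vector_assoc[symmetric] mult_nonneg_nonpos)

lemma nsd_0: "nsd 0"
  using subspace_0[OF subspace_sym_mats] by (simp add: nsd_def)

lemma psd_add: "psd P \<Longrightarrow> psd Q \<Longrightarrow> psd (P + Q)"
  using subspace_add[OF subspace_sym_mats]
  by (auto simp: psd_def matrix_vector_mult_add_rdistrib inner_add_right)

lemma psd_scaleR: "psd P \<Longrightarrow> c \<ge> 0 \<Longrightarrow> psd (c *\<^sub>R P)"
  using subspace_scale[OF subspace_sym_mats]
  by (auto simp: psd_def scaleR_matrix_vector_assoc[symmetric])

lemma matrix_vector_mult_uminus: "(- P :: real^'n^'m) *v v = - (P *v v)"
  by (simp add: matrix_vector_mult_def vec_eq_iff sum_negf)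

lemma psd_uminus_iff: "psd (- P) \<longleftrightarrow> nsd P"
proof -
  have "- P \<in> sym_mats \<longleftrightarrow> P \<in> sym_mats"
    using subspace_neg[OF subspace_sym_mats, of P] subspace_neg[OF subspace_sym_mats, of "- P"] by auto
  then show ?thesis by (simp add: psd_def nsd_def matrix_vector_mult_uminus)
qed

lemma cert_set_add:
  assumes "M \<in> cert_set A X" "N \<in> cert_set A X"
  shows "M + N \<in> cert_set A X"
proof -
  obtain l Q k R where "M = meas_adj A l + Q" "nsd Q" "orthogonal Q X"
    "N = meas_adj A k + R" "nsd R" "orthogonal R X"
    using assms by (auto simp: cert_set_def)
  then have "M + N = meas_adj A (l + k) + (Q + R)" "nsd (Q + R)" "orthogonal (Q + R) X"
    by (auto simp: meas_adj_add nsd_add orthogonal_def inner_add_left)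
  then show ?thesis unfolding cert_set_def by blast
qed

lemma cert_set_scaleR:
  assumes "M \<in> cert_set A X" "c \<ge> 0"
  shows "c *\<^sub>R M \<in> cert_set A X"
proof -
  obtain l Q where "M = meas_adj A l + Q" "nsd Q" "orthogonal Q X"
    using assms by (auto simp: cert_set_def)
  then have "c *\<^sub>R M = meas_adj A (c *\<^sub>R l) + c *\<^sub>R Q" "nsd (c *\<^sub>R Q)" "orthogonal (c *\<^sub>R Q) X"
    using assms by (auto simp: meas_adj_scaleR nsd_scaleR orthogonal_def scaleR_right_distrib)
  then show ?thesis unfolding cert_set_def by blast
qed

lemma meas_adj_mem_cert_set: "meas_adj A l \<in> cert_set A X"
proof -
  have "meas_adj A l = meas_adj A l + 0" "orthogonal 0 X" by (auto simp: orthogonal_def)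
  then show ?thesis unfolding cert_set_def using nsd_0 by blast
qed

text \<open>The elements of a convex cone whose negatives also lie in it form a subspace, the
  lineality space of the cone.\<close>

lemma span_subset_cert_set:
  assumes "\<And>M. M \<in> B \<Longrightarrow> M \<in> cert_set A X \<and> - M \<in> cert_set A X"
  shows "span B \<subseteq> cert_set A X"
proof -
  have "subspace {M. M \<in> cert_set A X \<and> - M \<in> cert_set A X}" (is "subspace ?L")
  proof (rule subspaceI)
    show "0 \<in> ?L"
      using cert_set_scaleR[OF meas_adj_mem_cert_set[of A 0 X], of 0] by simp
    show "M + N \<in> ?L" if "M \<in> ?L" "N \<in> ?L" for M N
      using that cert_set_add[of M A X N] cert_set_add[of "- M" A X "- N"] by simp
    show "c *\<^sub>R M \<in> ?L" if "M \<in> ?L" for c M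
    proof (cases "c \<ge> 0")
      case True
      then show ?thesis using that cert_set_scaleR[of M A X c] cert_set_scaleR[of "- M" A X c] by simp
    next
      case False
      then show ?thesis using that cert_set_scaleR[of M A X "- c"] cert_set_scaleR[of "- M" A X "- c"] by simp
    qed
  qed
  then have "span B \<subseteq> ?L" using assms by (intro span_minimal) auto
  then show ?thesis by auto
qed

section \<open>Facial reduction and normals of the feasible set\<close>

lemma sym_mats_range_kernel:
  assumes "E \<in> sym_mats"
  obtains u k where "v = E *v u + k" "E *v k = 0"
proof -
  have sp: "subspace (range ((*v) E))" by (intro linear_subspace_image) auto
  obtain q k where qk: "q \<in> range ((*v) E)" "\<And>w. w \<in> range ((*v) E) \<Longrightarrow> orthogonal k w" "v = q + k"
    using orthogonal_subspace_decomp_exists[of "range ((*v) E)" v] span_eq_iff[THEN iffD2, OF sp] by metis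
  have "(E *v k) \<bullet> (E *v k) = k \<bullet> (E *v (E *v k))"
    using sym_mats_inner_commute[OF assms] by simp
  also have "\<dots> = 0" using qk(2)[of "E *v (E *v k)"] by (simp add: orthogonal_def)
  finally have "E *v k = 0" by simp
  then show ?thesis using qk that by blast
qed

text \<open>Kernel dimensions are natural numbers, so a least one is attained; \<open>0\<close> is a
  candidate. Least kernel dimension means maximal rank.\<close>

lemma exposing_matrix_exists:
  obtains l where "psd (meas_adj A l)" "orthogonal (meas_adj A l) X"
    "\<And>k. psd (meas_adj A k) \<Longrightarrow> orthogonal (meas_adj A k) X \<Longrightarrow>
      dim {v. meas_adj A l *v v = 0} \<le> dim {v. meas_adj A k *v v = 0}"
proof -
  let ?P = "\<lambda>l. psd (meas_adj A l) \<and> orthogonal (meas_adj A l) X"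
  have "meas_adj A 0 = 0" by (simp add: meas_adj_def)
  then have "?P 0" using subspace_0[OF subspace_sym_mats] by (simp add: psd_def orthogonal_def)
  then show ?thesis
    using ex_has_least_nat[of ?P 0 "\<lambda>l. dim {v. meas_adj A l *v v = 0}"] that by blast
qed

text \<open>The maximal-rank choice of \<open>meas_adj A l\<close> is what makes a single facial reduction
  step enough: a further exposing matrix \<open>B\<close> would, by completeness, lift to one of
  larger rank.\<close>

lemma no_further_reduction:
  assumes l: "psd (meas_adj A l)" "orthogonal (meas_adj A l) X"
    and max: "\<And>k. psd (meas_adj A k) \<Longrightarrow> orthogonal (meas_adj A k) X \<Longrightarrow>
      dim {v. meas_adj A l *v v = 0} \<le> dim {v. meas_adj A k *v v = 0}"
    and B: "psd B" "orthogonal B X" "B \<in> cert_set A X" "\<And>u. B *v (meas_adj A l *v u) = 0"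
  shows "B = 0"
proof -
  let ?E = "meas_adj A l"
  let ?K = "\<lambda>M :: real^'n^'n. {v. M *v v = 0}"
  obtain k Q where kQ: "B = meas_adj A k + Q" "nsd Q" "orthogonal Q X"
    using B by (auto simp: cert_set_def)
  have eq: "meas_adj A (l + k) = ?E + B + (- Q)" by (simp add: kQ meas_adj_add)
  have "psd (meas_adj A (l + k))"
    unfolding eq using l B kQ by (intro psd_add) (auto simp: psd_uminus_iff)
  moreover have "orthogonal (meas_adj A (l + k)) X"
    unfolding eq using l B kQ by (simp add: orthogonal_def inner_add_left inner_diff_left)
  ultimately have dim: "dim (?K ?E) \<le> dim (?K (meas_adj A (l + k)))" by (rule max)
  \<comment> \<open>The kernel of a sum of positive semidefinite matrices lies in the kernel of each
    summand.\<close>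
  have ker: "?E *v v = 0 \<and> B *v v = 0" if "meas_adj A (l + k) *v v = 0" for v
  proof -
    have "v \<bullet> (?E *v v) + v \<bullet> (B *v v) + v \<bullet> ((- Q) *v v) = 0"
      using arg_cong[OF that, of "inner v"]
      unfolding eq matrix_vector_mult_add_rdistrib inner_add_right by simp
    moreover have "0 \<le> v \<bullet> (?E *v v)" "0 \<le> v \<bullet> (B *v v)" "0 \<le> v \<bullet> ((- Q) *v v)"
      using l B kQ psd_uminus_iff[of Q] by (auto simp: psd_def)
    ultimately have "v \<bullet> (?E *v v) = 0" "v \<bullet> (B *v v) = 0" by linarith+
    then show ?thesis using l B psd_mult_vec_eq_0 by blast
  qed
  have sp: "subspace (?K M)" for M :: "real^'n^'n"
    by (auto simp: subspace_def matrix_vector_right_distrib matrix_vector_mult_scaleR)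
  \<comment> \<open>Minimality turns the inclusion of kernels into equality, so \<open>B\<close>
    kills the kernel of \<open>?E\<close> in addition to its range.\<close>
  have "?K (meas_adj A (l + k)) = ?K ?E"
    using ker dim by (intro subspace_dim_equal sp) auto
  then have kerB: "B *v v = 0" if "?E *v v = 0" for v using ker that by blast
  have "B *v v = 0" for v
    using sym_mats_range_kernel[of ?E v] l B(4) kerB
    by (metis matrix_vector_right_distrib psd_def)
  then show ?thesis by (simp add: matrix_eq)
qed

text \<open>This is the double orthogonal complement taken inside \<open>sym_mats\<close>: the
  residual of projecting \<open>M\<close> onto \<open>span B\<close> is again symmetric and may
  serve as \<open>H\<close>.\<close>

lemma sym_double_orthogonal:
  assumes "B \<subseteq> sym_mats" "M \<in> sym_mats"
    and "\<And>H. H \<in> sym_mats \<Longrightarrow> (\<And>u. u \<in> B \<Longrightarrow> H \<bullet> u = 0) \<Longrightarrow> M \<bullet> H = 0"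
  shows "M \<in> span B"
proof -
  obtain u z where uz: "u \<in> span B" "\<And>w. w \<in> span B \<Longrightarrow> orthogonal z w" "M = u + z"
    using orthogonal_subspace_decomp_exists[of B M] by metis
  have "u \<in> sym_mats" using span_minimal[OF assms(1) subspace_sym_mats] uz by blast
  then have "z \<in> sym_mats" using uz assms(2) subspace_diff[OF subspace_sym_mats, of M u] by simp
  then have "M \<bullet> z = 0" using uz(2) span_base by (intro assms(3)) (auto simp: orthogonal_def)
  moreover have "u \<bullet> z = 0" using uz by (simp add: orthogonal_def inner_commute)
  ultimately have "z = 0" using uz(3) by (simp add: inner_add_left)
  then show ?thesis using uz by simp
qed

text \<open>The separating matrix \<open>M\<close> below is a normal of the reduced positive
  definite cone \<open>P\<close>; no Slater point has to be constructed, since degenerate separation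
  is excluded by maximality of the rank.\<close>

lemma normal_mem_cert_set:
  fixes A :: "'m::finite \<Rightarrow> real ^ 'n ^ 'n" and x0 :: "real ^ 'n"
  defines "X0 \<equiv> outer x0 x0"
  assumes A: "\<And>i. A i \<in> sym_mats" and compl: "completeness A x0" and N: "N \<in> sym_mats"
    and normal: "\<And>X. feasible A (meas A X0) X \<Longrightarrow> N \<bullet> (X - X0) \<le> 0"
  shows "N \<in> cert_set A X0"
proof -
  obtain l where l: "psd (meas_adj A l)" "orthogonal (meas_adj A l) X0"
    and max: "\<And>k. psd (meas_adj A k) \<Longrightarrow> orthogonal (meas_adj A k) X0 \<Longrightarrow>
      dim {v. meas_adj A l *v v = 0} \<le> dim {v. meas_adj A k *v v = 0}"
    using exposing_matrix_exists[of A X0] by metis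
  define E where "E = meas_adj A l"
  have Esym: "E \<in> sym_mats" using l by (simp add: E_def psd_def)
  have Ex0: "E *v x0 = 0"
    using l psd_mult_vec_eq_0 by (auto simp: X0_def E_def orthogonal_def inner_outer)
  \<comment> \<open>These generators lie in the lineality space of the certificate cone: the
    \<open>A i\<close> trivially, the tensors by completeness.\<close>
  define B where "B = range A \<union> {sym_tensor y (E *v u) | y u. True}"
  have Bsym: "B \<subseteq> sym_mats" using A sym_tensor_mem_sym_mats by (auto simp: B_def)
  have tensor: "sym_tensor y (E *v u) \<in> cert_set A X0" for y u
    using compl l unfolding completeness_def E_def X0_def by blast
  have U: "span B \<subseteq> cert_set A X0"
  proof (rule span_subset_cert_set)
    fix M assume "M \<in> B"
    then consider i where "M = A i" | y u where "M = sym_tensor y (E *v u)" by (auto simp: B_def)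
    then show "M \<in> cert_set A X0 \<and> - M \<in> cert_set A X0"
    proof cases
      case (1 i)
      then show ?thesis
        using meas_adj_mem_cert_set[of A "axis i 1" X0] meas_adj_mem_cert_set[of A "axis i (-1)" X0]
        by (simp add: meas_adj_axis)
    next
      case (2 y u)
      then show ?thesis using tensor[of y u] tensor[of "- y" u] by (simp add: uminus_sym_tensor)
    qed
  qed
  \<comment> \<open>The symmetric directions that preserve the measurements and kill the range of
    \<open>E\<close>.\<close>
  define V where "V = {H \<in> sym_mats. \<forall>u\<in>B. H \<bullet> u = 0}"
  have subV: "subspace V"
    using subspace_sym_mats by (auto simp: V_def subspace_def inner_add_left)
  have perpV: "M \<in> span B" if "M \<in> sym_mats" "\<And>H. H \<in> V \<Longrightarrow> M \<bullet> H = 0" for M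
    by (rule sym_double_orthogonal[OF Bsym]) (use that in \<open>auto simp: V_def\<close>)
  have perp_tensor: "M *v (E *v u) = 0" if "M \<in> sym_mats" "\<And>y. M \<bullet> sym_tensor y (E *v u) = 0" for M u
    using that(2)[of "M *v (E *v u)"] that(1) by (simp add: inner_sym_tensor)
  \<comment> \<open>Positive definiteness on the kernel of \<open>E\<close> modulo multiples of
    \<open>X0\<close>. The real \<open>s\<close> may have either sign and \<open>H\<close> may be
    any square matrix; both freedoms later constrain the separating normal \<open>M\<close>.\<close>
  define P where "P = {H. \<exists>s. \<forall>v. E *v v = 0 \<longrightarrow> v \<noteq> 0 \<longrightarrow> 0 < (s *\<^sub>R X0 + H) \<bullet> outer v v}"
  have X0nonneg: "0 \<le> X0 \<bullet> outer v v" for v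
    by (simp add: X0_def inner_outer outer_mult_vec inner_commute)
  have N_le: "N \<bullet> H \<le> 0" if H: "H \<in> V" "H \<in> P" for H
  proof -
    obtain s where s: "\<And>v. E *v v = 0 \<Longrightarrow> v \<noteq> 0 \<Longrightarrow> 0 < (s *\<^sub>R X0 + H) \<bullet> outer v v"
      using H unfolding P_def by blast
    define r where "r = \<bar>s\<bar> + 1"
    have r: "r > 0" "r \<ge> s" by (auto simp: r_def)
    define Y where "Y = r *\<^sub>R X0 + H"
    have Hsym: "H \<in> sym_mats" using that by (simp add: V_def)
    have Ysym: "Y \<in> sym_mats"
      unfolding Y_def X0_def
      by (intro subspace_add subspace_scale subspace_sym_mats outer_mem_sym_mats Hsym)
    have "H *v (E *v u) = 0" for u
      using H(1) Hsym by (intro perp_tensor) (auto simp: V_def B_def)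
    moreover have "X0 *v (E *v u) = 0" for u
      using sym_mats_inner_commute[OF Esym, of x0 u] Ex0 by (simp add: X0_def outer_mult_vec)
    ultimately have YE: "Y *v (E *v u) = 0" for u
      by (simp add: Y_def matrix_vector_mult_add_rdistrib scaleR_matrix_vector_assoc[symmetric])
    have "psd Y"
      unfolding psd_def
    proof (intro conjI allI Ysym)
      fix v
      \<comment> \<open>As \<open>Y\<close> kills the range of \<open>E\<close>, only the kernel
        component of \<open>v\<close> contributes to the form.\<close>
      obtain u k where uk: "v = E *v u + k" "E *v k = 0" by (rule sym_mats_range_kernel[OF Esym])
      have "v \<bullet> (Y *v v) = k \<bullet> (Y *v k)"
        using sym_mats_inner_commute[OF Ysym, of "E *v u" k]
        by (simp add: uk(1) matrix_vector_right_distrib YE inner_add_left)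
      also have "\<dots> = Y \<bullet> outer k k" by (simp add: inner_outer)
      also have "0 \<le> \<dots>"
      proof (cases "k = 0")
        case False
        have "0 < (s *\<^sub>R X0 + H) \<bullet> outer k k" by (rule s[OF uk(2) False])
        also have "\<dots> \<le> Y \<bullet> outer k k"
          using mult_right_mono[OF r(2) X0nonneg[of k]] by (simp add: Y_def inner_add_left)
        finally show ?thesis by simp
      qed (simp add: inner_outer)
      finally show "0 \<le> v \<bullet> (Y *v v)" .
    qed
    then have "psd ((1 / r) *\<^sub>R Y)" using r by (intro psd_scaleR) auto
    moreover have Yr: "(1 / r) *\<^sub>R Y = X0 + (1 / r) *\<^sub>R H"
      using r by (simp add: Y_def scaleR_right_distrib)
    moreover have "meas A H = 0"
      unfolding meas_def vec_eq_iff using H(1) by (simp add: V_def B_def)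
    ultimately have "feasible A (meas A X0) (X0 + (1 / r) *\<^sub>R H)"
      by (simp add: feasible_def meas_add meas_scaleR)
    from normal[OF this] show ?thesis using r by (simp add: divide_le_0_iff)
  qed
  show ?thesis
  proof (cases "\<exists>H\<in>V. N \<bullet> H > 0")
    case False
    have "N \<bullet> H = 0" if "H \<in> V" for H
      using bspec[of V "\<lambda>H. \<not> N \<bullet> H > 0" H] bspec[of V "\<lambda>H. \<not> N \<bullet> H > 0" "- H"]
        False that subspace_neg[OF subV that] by auto
    then show ?thesis using perpV[OF N] U by blast
  next
    case True
    then obtain H0 where H0: "H0 \<in> V" "N \<bullet> H0 > 0" by blast
    \<comment> \<open>By \<open>N_le\<close> this open half of \<open>V\<close> misses
      \<open>P\<close>, so the two convex cones can be separated.\<close>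
    define T where "T = {H \<in> V. N \<bullet> H > 0}"
    have "convex T"
    proof -
      have "T = V \<inter> {H. N \<bullet> H > 0}" by (auto simp: T_def)
      then show ?thesis using convex_halfspace_gt subspace_imp_convex[OF subV] by (auto intro: convex_Int)
    qed
    have outer_pos: "mat 1 \<bullet> outer v v > 0" if "v \<noteq> 0" for v :: "real^'n"
      using that by (simp add: inner_outer)
    have P_scale: "c *\<^sub>R H \<in> P" if H: "H \<in> P" "c > 0" for c H
    proof -
      obtain s where s: "\<And>v. E *v v = 0 \<Longrightarrow> v \<noteq> 0 \<Longrightarrow> 0 < (s *\<^sub>R X0 + H) \<bullet> outer v v"
        using H unfolding P_def by blast
      have "((c * s) *\<^sub>R X0 + c *\<^sub>R H) \<bullet> w = c * ((s *\<^sub>R X0 + H) \<bullet> w)" for w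
        by (simp add: algebra_simps)
      then show ?thesis unfolding P_def using s that by (intro CollectI exI[of _ "c * s"]) simp
    qed
    have P_add: "H + G \<in> P" if H: "H \<in> P" "G \<in> P" for H G
    proof -
      obtain s where s: "\<And>v. E *v v = 0 \<Longrightarrow> v \<noteq> 0 \<Longrightarrow> 0 < (s *\<^sub>R X0 + H) \<bullet> outer v v"
        using H unfolding P_def by blast
      obtain r where r: "\<And>v. E *v v = 0 \<Longrightarrow> v \<noteq> 0 \<Longrightarrow> 0 < (r *\<^sub>R X0 + G) \<bullet> outer v v"
        using H unfolding P_def by blast
      have "((s + r) *\<^sub>R X0 + (H + G)) \<bullet> w = (s *\<^sub>R X0 + H) \<bullet> w + (r *\<^sub>R X0 + G) \<bullet> w" for w
        by (simp add: algebra_simps)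
      then show ?thesis unfolding P_def using s r by (intro CollectI exI[of _ "s + r"]) (simp add: add_pos_pos)
    qed
    have "convex P"
    proof (rule convexI)
      fix H G and u v :: real
      assume *: "H \<in> P" "G \<in> P" "0 \<le> u" "0 \<le> v" "u + v = 1"
      then consider "u = 0" "v = 1" | "v = 0" "u = 1" | "u > 0" "v > 0" by linarith
      then show "u *\<^sub>R H + v *\<^sub>R G \<in> P"
        by cases (use * P_scale P_add in auto)
    qed
    have I_in_P: "mat 1 \<in> P"
      unfolding P_def by (intro CollectI exI[of _ 0]) (simp add: outer_pos)
    have "P \<inter> T = {}" using N_le by (force simp: T_def)
    moreover have "T \<noteq> {}" "P \<noteq> {}" using H0 I_in_P by (auto simp: T_def)
    ultimately obtain M \<beta> where M: "M \<noteq> 0" "\<And>H. H \<in> P \<Longrightarrow> M \<bullet> H \<le> \<beta>" "\<And>H. H \<in> T \<Longrightarrow> \<beta> \<le> M \<bullet> H"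
      using separating_hyperplane_sets[OF \<open>convex P\<close> \<open>convex T\<close>] by blast
    \<comment> \<open>Such a \<open>D\<close> can be added to the identity with any real factor
      without leaving \<open>P\<close>, where \<open>M\<close> is bounded above.\<close>
    have null: "M \<bullet> D = 0" if "\<And>v. E *v v = 0 \<Longrightarrow> D \<bullet> outer v v = 0" for D
    proof (rule affine_bound_imp_zero)
      fix t
      have "mat 1 + t *\<^sub>R D \<in> P"
        unfolding P_def by (intro CollectI exI[of _ 0]) (simp add: that outer_pos inner_add_left)
      from M(2)[OF this] show "M \<bullet> mat 1 + t * (M \<bullet> D) \<le> \<beta>" by (simp add: inner_add_right)
    qed
    have MX0: "M \<bullet> X0 = 0"
    proof (rule affine_bound_imp_zero)
      fix t
      have "mat 1 + t *\<^sub>R X0 \<in> P"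
        \<comment> \<open>The choice \<open>- t\<close> cancels the added multiple of
          \<open>X0\<close>.\<close>
        unfolding P_def by (intro CollectI exI[of _ "- t"]) (simp add: outer_pos)
      from M(2)[OF this] show "M \<bullet> mat 1 + t * (M \<bullet> X0) \<le> \<beta>" by (simp add: inner_add_right)
    qed
    have "M \<in> sym_mats"
    proof -
      let ?D = "M - transpose M"
      have tr: "transpose M \<bullet> Y = M \<bullet> transpose Y" for Y
        using inner_transpose[of M "transpose Y"] by simp
      have D: "?D \<bullet> Y = M \<bullet> Y - M \<bullet> transpose Y" for Y
        by (simp add: inner_diff_left tr)
      \<comment> \<open>The antisymmetric matrix \<open>?D\<close> has zero quadratic form, and its
        squared norm is twice \<open>M \<bullet> ?D\<close>.\<close>
      have "M \<bullet> ?D = 0" by (rule null) (simp add: D transpose_outer)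
      then have "?D \<bullet> ?D = 0"
        using inner_transpose[of M M] by (simp add: inner_diff_left inner_diff_right inner_commute)
      then show ?thesis by (simp add: sym_mats_def)
    qed
    have "v \<bullet> (M *v v) \<le> 0" for v
    proof -
      have "M \<bullet> outer v v \<le> 0"
      proof (rule affine_bound_imp_nonpos)
        fix t :: real assume "t > 0"
        have "0 \<le> outer v v \<bullet> outer w w" for w
          by (simp add: inner_outer outer_mult_vec inner_commute)
        then have "mat 1 + t *\<^sub>R outer v v \<in> P"
          using \<open>t > 0\<close> unfolding P_def
          by (intro CollectI exI[of _ 0]) (simp add: outer_pos inner_add_left add_pos_nonneg)
        from M(2)[OF this] show "M \<bullet> mat 1 + t * (M \<bullet> outer v v) \<le> \<beta>" by (simp add: inner_add_right)
      qed
      then show ?thesis by (simp add: inner_outer)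
    qed
    with \<open>M \<in> sym_mats\<close> have Mnsd: "nsd M" by (simp add: nsd_def)
    have ME: "M *v (E *v u) = 0" for u
    \<comment> \<open>The range of \<open>E\<close> is orthogonal to its kernel, so these tensors
      vanish as forms on the kernel.\<close>
    proof (rule perp_tensor[OF \<open>M \<in> sym_mats\<close>], rule null)
      fix y v assume "E *v v = 0"
      then have "(E *v u) \<bullet> v = 0"
        using sym_mats_inner_commute[OF Esym, of u v] by simp
      then show "sym_tensor y (E *v u) \<bullet> outer v v = 0"
        using inner_sym_tensor[OF outer_mem_sym_mats, of v y "E *v u"]
        by (simp add: outer_mult_vec inner_commute)
    qed
    have MT: "0 \<le> M \<bullet> H" if "H \<in> T" for H
    proof -
      have "- (M \<bullet> H) \<le> 0"
      proof (rule affine_bound_imp_nonpos)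
        fix t :: real assume "t > 0"
        then have "t *\<^sub>R H \<in> T" using that subspace_scale[OF subV] by (simp add: T_def)
        from M(3)[OF this] show "\<beta> + t * - (M \<bullet> H) \<le> 0" by simp
      qed
      then show ?thesis by simp
    qed
    \<comment> \<open>Chosen so that \<open>M - \<mu> *\<^sub>R N\<close> vanishes at
      \<open>H0\<close>.\<close>
    define \<mu> where "\<mu> = (M \<bullet> H0) / (N \<bullet> H0)"
    have mu_nonneg: "\<mu> \<ge> 0" using MT[of H0] H0 by (simp add: \<mu>_def T_def)
    have comb: "(M - \<mu> *\<^sub>R N) \<bullet> H = 0" if "H \<in> V" for H
    proof -
      let ?G = "H - ((N \<bullet> H) / (N \<bullet> H0)) *\<^sub>R H0"
      have G: "?G \<in> V" "N \<bullet> ?G = 0"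
        using that H0 subV by (auto simp: subspace_diff subspace_scale inner_diff_right)
      \<comment> \<open>Moving from \<open>H0\<close> along \<open>?G\<close> leaves the value of
        \<open>N\<close> unchanged, so the whole line stays in \<open>T\<close>, where
        \<open>M\<close> is nonnegative.\<close>
      have "M \<bullet> ?G = 0"
      proof (rule affine_bound_imp_zero)
        fix t :: real
        have "H0 + (- t) *\<^sub>R ?G \<in> V" using G H0 subV by (intro subspace_add subspace_scale) auto
        moreover have "N \<bullet> (H0 + (- t) *\<^sub>R ?G) > 0"
          using H0 G(2) unfolding inner_add_right inner_scaleR_right by simp
        ultimately have "0 \<le> M \<bullet> (H0 + (- t) *\<^sub>R ?G)" by (intro MT) (simp add: T_def)
        then show "- (M \<bullet> H0) + t * (M \<bullet> ?G) \<le> 0"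
          unfolding inner_add_right inner_scaleR_right by simp
      qed
      then show ?thesis by (simp add: \<mu>_def inner_diff_right inner_diff_left)
    qed
    have MN: "M - \<mu> *\<^sub>R N \<in> sym_mats"
      using \<open>M \<in> sym_mats\<close> N by (intro subspace_diff subspace_scale subspace_sym_mats)
    have W: "M - \<mu> *\<^sub>R N \<in> span B" by (rule perpV[OF MN comb])
    \<comment> \<open>Otherwise \<open>- M\<close> would be a nonzero exposing matrix in the
      certificate cone that kills the range of \<open>E\<close>, against maximality of the
      rank.\<close>
    have "\<mu> \<noteq> 0"
    proof
      assume "\<mu> = 0"
      then have "- M \<in> cert_set A X0" using W U span_neg by fastforce
      then have "- M = 0"
        using Mnsd MX0 ME unfolding E_def
        by (intro no_further_reduction[OF l max]) (auto simp: psd_uminus_iff orthogonal_def matrix_vector_mult_uminus)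
      then show False using M(1) by simp
    qed
    with mu_nonneg have \<mu>: "\<mu> > 0" by simp
    have "M \<in> cert_set A X0"
    proof -
      have "M = meas_adj A 0 + M" by (simp add: meas_adj_def)
      moreover have "orthogonal M X0" using MX0 by (simp add: orthogonal_def)
      ultimately show ?thesis unfolding cert_set_def using Mnsd by blast
    qed
    moreover have "- (M - \<mu> *\<^sub>R N) \<in> cert_set A X0" using span_neg[OF W] U by blast
    \<comment> \<open>The left side is \<open>N\<close>, written as a positive multiple of a
      negative semidefinite matrix plus an element of \<open>span B\<close>.\<close>
    ultimately have "(1 / \<mu>) *\<^sub>R (M + - (M - \<mu> *\<^sub>R N)) \<in> cert_set A X0"
      using \<mu> by (intro cert_set_scaleR cert_set_add) auto
    then show ?thesis using \<mu> by simp
  qed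
qed

section \<open>Dual certificates and strong duality\<close>

lemma dual_certificate_exists:
  fixes f :: "real ^ 'n ^ 'n \<Rightarrow> real" and A :: "'m::finite \<Rightarrow> real ^ 'n ^ 'n"
  assumes f: "convex_on sym_mats f" and A: "\<And>i. A i \<in> sym_mats" and X0: "X0 = outer x0 x0"
    and min: "is_arg_min f (feasible A (meas A X0)) X0" and compl: "completeness A x0"
  shows "\<exists>l Q. dual_certificate f A X0 l Q"
proof -
  \<comment> \<open>The orthogonal projection onto \<open>sym_mats\<close> extends \<open>f\<close>
    to a convex function on all square matrices. Being self-adjoint, it turns a subgradient
    \<open>G\<close> of the extension into a symmetric one that agrees with \<open>G\<close> on
    symmetric directions.\<close>
  define p where "p = (\<lambda>X :: real^'n^'n. (1 / 2) *\<^sub>R (X + transpose X))"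
  have tr_add: "transpose (X + Y) = transpose X + transpose Y" for X Y :: "real^'n^'n"
    by (simp add: transpose_def vec_eq_iff)
  have tr_scale: "transpose (c *\<^sub>R X) = c *\<^sub>R transpose X" for c and X :: "real^'n^'n"
    by (simp add: transpose_def vec_eq_iff)
  have p_sym: "p X \<in> sym_mats" for X
    by (simp add: p_def sym_mats_def tr_add tr_scale add.commute)
  have p_id: "p X = X" if "X \<in> sym_mats" for X
    using that by (simp add: p_def sym_mats_def flip: scaleR_2)
  have p_lin: "p (u *\<^sub>R X + v *\<^sub>R Y) = u *\<^sub>R p X + v *\<^sub>R p Y" for u v X Y
    by (simp add: p_def tr_add tr_scale algebra_simps)
  have p_adj: "p X \<bullet> Y = X \<bullet> p Y" for X Y
    using inner_transpose[of X "transpose Y"] by (simp add: p_def inner_add_left inner_add_right)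
  have fp: "convex_on UNIV (\<lambda>X. f (p X))"
    using f p_sym by (auto simp: convex_on_def p_lin)
  have feas_sym: "X \<in> sym_mats" if "feasible A b X" for X b
    using that by (simp add: feasible_def psd_def)
  let ?C = "Collect (feasible A (meas A X0))"
  have X0min: "X0 \<in> ?C" "\<And>X. X \<in> ?C \<Longrightarrow> f X0 \<le> f X"
    using min by (auto simp: is_arg_min_def not_less)
  have "convex ?C"
    by (rule convexI)
      (auto simp: feasible_def psd_add psd_scaleR meas_add meas_scaleR simp flip: scaleR_left_distrib)
  moreover have "f (p X0) \<le> f (p X)" if "X \<in> ?C" for X
    using X0min(2)[OF that] p_id feas_sym that X0min(1) by simp
  ultimately obtain G where G: "\<And>Y. f (p X0) + G \<bullet> (Y - X0) \<le> f (p Y)" "\<And>X. X \<in> ?C \<Longrightarrow> 0 \<le> G \<bullet> (X - X0)"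
    using constrained_minimizer_subgradient[OF fp _ X0min(1)] by blast
  have X0sym: "X0 \<in> sym_mats" using X0min feas_sym by blast
  have pG: "p G \<bullet> (Y - X0) = G \<bullet> (Y - X0)" if "Y \<in> sym_mats" for Y
    using that X0sym by (simp only: p_adj p_id subspace_diff[OF subspace_sym_mats])
  have "p G \<in> subdifferential f X0"
    unfolding subdifferential_def
  proof (intro CollectI conjI ballI p_sym)
    show "f X0 + p G \<bullet> (Y - X0) \<le> f Y" if "Y \<in> sym_mats" for Y
      using G(1)[of Y] that pG X0sym by (simp add: p_id)
  qed
  moreover have "- p G \<in> cert_set A (outer x0 x0)"
  proof (rule normal_mem_cert_set[OF A compl])
    show "- p G \<in> sym_mats" using p_sym subspace_neg[OF subspace_sym_mats] by blast
    show "- p G \<bullet> (X - outer x0 x0) \<le> 0" if "feasible A (meas A (outer x0 x0)) X" for X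
      using that G(2)[of X] pG[of X] feas_sym X0 by simp
  qed
  then obtain l Q where "- p G = meas_adj A l + Q" "nsd Q" "orthogonal Q X0"
    by (auto simp: cert_set_def X0)
  ultimately show ?thesis unfolding dual_certificate_def by (metis image_eqI)
qed

text \<open>Evaluating the Lagrangian at \<open>X0\<close> bounds every dual value by
  \<open>f X0\<close>. For the certificate, the subgradient inequality makes \<open>X0\<close> a
  global minimizer of the Lagrangian on \<open>sym_mats\<close>, so the bound is attained.\<close>

lemma strong_duality_if_dual_certificate:
  fixes f :: "real ^ 'n ^ 'n \<Rightarrow> real" and A :: "'m::finite \<Rightarrow> real ^ 'n ^ 'n"
  assumes X0: "X0 = outer x0 x0" and min: "is_arg_min f (feasible A (meas A X0)) X0"
    and cert: "dual_certificate f A X0 l Q"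
  shows "strong_duality f A (meas A X0)"
proof -
  let ?b = "meas A X0"
  have X0min: "feasible A ?b X0" "\<And>X. feasible A ?b X \<Longrightarrow> f X0 \<le> f X"
    using min by (auto simp: is_arg_min_def not_less)
  have primal: "primal_value f A ?b = f X0"
    unfolding primal_value_def using X0min by (intro antisym INF_lower INF_greatest) auto
  have X0sym: "X0 \<in> sym_mats" by (simp add: X0 outer_mem_sym_mats)
  have upper: "dual_function f A ?b k R \<le> f X0" if "nsd R" for k R
  proof -
    have "R \<bullet> X0 \<le> 0" using that by (simp add: X0 inner_outer nsd_def)
    then have "lagrangian f A ?b X0 k R \<le> f X0" by (simp add: lagrangian_def)
    then show ?thesis
      unfolding dual_function_def using X0sym by (intro INF_lower2[of X0]) auto
  qed
  have Q: "nsd Q" "Q \<bullet> X0 = 0" using cert by (auto simp: dual_certificate_def orthogonal_def)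
  obtain G where G: "meas_adj A l + Q = - G" "G \<in> subdifferential f X0"
    using cert by (auto simp: dual_certificate_def)
  have "f X0 \<le> lagrangian f A ?b X l Q" if "X \<in> sym_mats" for X
  proof -
    \<comment> \<open>Complementarity, \<open>Q \<bullet> X0 = 0\<close>, permits replacing
      \<open>X\<close> by \<open>X - X0\<close> in the last term.\<close>
    have "l \<bullet> (meas A X - ?b) + Q \<bullet> X = (meas_adj A l + Q) \<bullet> (X - X0)"
      using Q by (simp add: inner_diff_right inner_meas inner_add_left)
    then have "lagrangian f A ?b X l Q = f X - G \<bullet> (X - X0)"
      unfolding G(1) by (simp add: lagrangian_def)
    moreover have "f X0 + G \<bullet> (X - X0) \<le> f X"
      using G(2) that by (auto simp: subdifferential_def)
    ultimately show ?thesis by linarith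
  qed
  then have "f X0 \<le> dual_function f A ?b l Q"
    unfolding dual_function_def by (intro INF_greatest) auto
  with upper[OF Q(1)] have dual: "dual_function f A ?b l Q = f X0" by (intro antisym) auto
  have "dual_value f A ?b = f X0"
  proof (rule antisym)
    show "dual_value f A ?b \<le> f X0" unfolding dual_value_def using upper by (auto intro!: SUP_least)
    show "f X0 \<le> dual_value f A ?b"
      unfolding dual_value_def using Q(1) dual by (intro SUP_upper2[of "(l, Q)"]) auto
  qed
  then show ?thesis unfolding strong_duality_def using primal dual Q(1) by metis
qed

theorem theorem4:
  fixes f :: "real ^ 'n ^ 'n \<Rightarrow> real"
    and A :: "'m::finite \<Rightarrow> real ^ 'n ^ 'n"
    and x0 :: "real ^ 'n"
    and X0 :: "real ^ 'n ^ 'n"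
    and b :: "real ^ 'm"
  assumes "convex_on sym_mats f"
    and "continuous_on sym_mats f"
    and "\<And>i. A i \<in> sym_mats"
    and "X0 = outer x0 x0"
    and "b = meas A X0"
    and "is_arg_min f (feasible A b) X0"
    and "completeness A x0"
  shows "strong_duality f A b \<and> (\<exists>l Q. dual_certificate f A X0 l Q)"
  using assms dual_certificate_exists[of f A X0 x0] strong_duality_if_dual_certificate[of X0 x0 f A]
  by blast

end
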